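(* Let $\lambda$ be a nonzero real number, $\gamma$ a complex number, and $Y$ a random variable as in the context. For every integer $n\ge0$ with $\gamma\neq-n$, \[ D_{n,\lambda}^{(\gamma,Y)}=\frac{\gamma}{\gamma+n}\beta_{n,\lambda}^{(n+\gamma,Y)}. \]
   Context: $(x)_{0,\lambda}=1$, $(x)_{n,\lambda}=x(x-\lambda)\cdots(x-(n-1)\lambda)$ for $n\ge1$. $Y$ is a random variable whose moment-generating function $E[e^{tY}]$ exists for $|t|<r$ for some $r>0$, and $E[Y]\neq0$. $E[e_{\lambda}^{Y}(t)]$ denotes the formal power series $\sum_{n\ge0}E[(Y)_{n,\lambda}]\frac{t^n}{n!}$; the probabilistic degenerate logarithm $\log_{\lambda}^{Y}(1+t)$ is the compositional inverse of the delta series $E[e_{\lambda}^{Y}(t)]-1$. The probabilistic degenerate Bernoulli numbers of order $\gamma$: $\big(\frac{t}{E[e_{\lambda}^{Y}(t)]-1}\big)^{\gamma}=\sum_{n\ge0}\beta_{n,\lambda}^{(\gamma,Y)}\frac{t^n}{n!}$. The probabilistic degenerate Daehee numbers of order $\gamma$: $\big(\frac{\log_{\lambda}^{Y}(1+t)}{t}\big)^{\gamma}=\sum_{n\ge0}D_{n,\lambda}^{(\gamma,Y)}\frac{t^n}{n!}$. Complex powers of series with constant term $c=E[Y]^{\pm1}$ are taken as $c^{\gamma}(1+u)^{\gamma}=c^\gamma\sum_m\binom{\gamma}{m}u^m$ ($u(0)=0$), using one fixed determination $E[Y]^{s}$ ($s\in\mathbb C$) with $E[Y]^{s+s'}=E[Y]^sE[Y]^{s'}$,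 and $(1/E[Y])^{s}:=E[Y]^{-s}$. *)

theory Defs
  imports
    "HOL-Probability.Probability"
    "HOL-Computational_Algebra.Formal_Power_Series"
begin

definition deg_ffact :: "real \<Rightarrow> nat \<Rightarrow> real \<Rightarrow> real" where
  "deg_ffact x n l = (\<Prod>i<n. x - of_nat i * l)"

definition has_mgf :: "'a measure \<Rightarrow> ('a \<Rightarrow> real) \<Rightarrow> bool" where
  "has_mgf M Y \<longleftrightarrow> (\<exists>r>0. \<forall>t. \<bar>t\<bar> < r \<longrightarrow> integrable M (\<lambda>\<omega>. exp (t * Y \<omega>)))"

text \<open>
  A determination of the powers \<open>c\<^sup>s\<close> for complex \<open>s\<close>. Every choice
  \<open>s \<mapsto> exp (s * L)\<close> with \<open>exp L = c\<close> is one.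
\<close>
definition power_determination :: "complex \<Rightarrow> (complex \<Rightarrow> complex) \<Rightarrow> bool" where
  "power_determination c P \<longleftrightarrow> P 1 = c \<and> (\<forall>s s'. P (s + s') = P s * P s')"

lemma power_determination_exp: "exp L = c \<Longrightarrow> power_determination c (\<lambda>s. exp (s * L))"
  by (simp add: power_determination_def exp_add distrib_right)

lemma power_determination_powr: "c \<noteq> 0 \<Longrightarrow> power_determination c (\<lambda>s. c powr s)"
  by (simp add: power_determination_def powr_add)

text \<open>
  With \<open>c\<close> the constant term of \<open>f\<close> and \<open>Q\<close> a determination of its powers, this is
  \<open>Q s * (1 + u)\<^sup>s\<close> for \<open>f = c * (1 + u)\<close>, the second factor being the binomial series.
\<close>
definition fps_cpow :: "(complex \<Rightarrow> complex) \<Rightarrow> complex fps \<Rightarrow> complex \<Rightarrow> complex fps" where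
  "fps_cpow Q f s =
     fps_const (Q s) *
     fps_compose (Abs_fps (\<lambda>m. s gchoose m)) (fps_const (inverse (fps_nth f 0)) * f - 1)"

definition prob_deg_exp :: "'a measure \<Rightarrow> ('a \<Rightarrow> real) \<Rightarrow> real \<Rightarrow> complex fps" where
  "prob_deg_exp M Y l =
     Abs_fps (\<lambda>n. complex_of_real (\<integral>\<omega>. deg_ffact (Y \<omega>) n l \<partial>M) / fact n)"

text \<open>The series \<open>log\<^sub>\<lambda>\<^sup>Y (1 + t)\<close> in the variable \<open>t\<close>.\<close>
definition prob_deg_log :: "'a measure \<Rightarrow> ('a \<Rightarrow> real) \<Rightarrow> real \<Rightarrow> complex fps" where
  "prob_deg_log M Y l = fps_inv (prob_deg_exp M Y l - 1)"

text \<open>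
  In the next two definitions \<open>P\<close> is a determination of the powers of \<open>E[Y]\<close>. The series
  raised to the power \<open>g\<close> both have constant term \<open>1 / E[Y]\<close>, whose powers are determined
  by \<open>(1 / E[Y])\<^sup>s = E[Y]\<^sup>-\<^sup>s\<close>.
\<close>
definition prob_deg_bernoulli ::
  "(complex \<Rightarrow> complex) \<Rightarrow> 'a measure \<Rightarrow> ('a \<Rightarrow> real) \<Rightarrow> real \<Rightarrow> complex \<Rightarrow> nat \<Rightarrow> complex" where
  "prob_deg_bernoulli P M Y l g n =
     fact n * fps_nth (fps_cpow (\<lambda>s. P (- s)) (fps_X / (prob_deg_exp M Y l - 1)) g) n"

definition prob_deg_daehee ::
  "(complex \<Rightarrow> complex) \<Rightarrow> 'a measure \<Rightarrow> ('a \<Rightarrow> real) \<Rightarrow> real \<Rightarrow> complex \<Rightarrow> nat \<Rightarrow> complex" where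
  "prob_deg_daehee P M Y l g n =
     fact n * fps_nth (fps_cpow (\<lambda>s. P (- s)) (prob_deg_log M Y l / fps_X) g) n"

lemma (in prob_space) prob_deg_exp_minus_1_nth:
  "fps_nth (prob_deg_exp M Y l - 1) 0 = 0"
  "fps_nth (prob_deg_exp M Y l - 1) (Suc 0) = complex_of_real (expectation Y)"
  by (simp_all add: prob_deg_exp_def deg_ffact_def prob_space)

lemma (in prob_space) constant_terms:
  assumes "expectation Y \<noteq> 0"
  shows "fps_nth (fps_X / (prob_deg_exp M Y l - 1)) 0 = inverse (complex_of_real (expectation Y))"
    and "fps_nth (prob_deg_log M Y l / fps_X) 0 = inverse (complex_of_real (expectation Y))"
proof -
  define f where "f = prob_deg_exp M Y l - 1"
  have f0: "fps_nth f 0 = 0" and f1: "fps_nth f (Suc 0) = complex_of_real (expectation Y)"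
    unfolding f_def by (rule prob_deg_exp_minus_1_nth)+
  have sd: "subdegree f = 1"
    using assms by (intro subdegreeI) (auto simp: f0 f1)
  show "fps_nth (fps_X / (prob_deg_exp M Y l - 1)) 0 = inverse (complex_of_real (expectation Y))"
    unfolding f_def[symmetric] by (simp add: fps_divide_def sd f1)
  show "fps_nth (prob_deg_log M Y l / fps_X) 0 = inverse (complex_of_real (expectation Y))"
    unfolding prob_deg_log_def f_def[symmetric]
    by (simp add: fps_inv_def fps_divide_def f0 f1 inverse_eq_divide)
qed

end

theory Submission
  imports Defs
begin

text \<open>
  The identity is an instance of Lagrange inversion. Let \<open>f = E[e\<^sub>\<lambda>\<^sup>Y(t)] - 1\<close>, let \<open>h\<close> be its
  compositional inverse and \<open>\<phi> = t / f\<close>. Since \<open>(h / t) \<circ> f = \<phi>\<close>, the series \<open>(h / t)\<^sup>\<gamma>\<close>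
  composed with \<open>f\<close> is \<open>\<phi>\<^sup>\<gamma>\<close>. For every series \<open>H\<close>, \<open>n H\<^sub>n\<close> is the coefficient of \<open>t\<^sup>n\<^sup>-\<^sup>1\<close>
  in \<open>(H \<circ> f)' \<phi>\<^sup>n\<close>; for \<open>H = (h / t)\<^sup>\<gamma>\<close> the latter series is
  \<open>(\<phi>\<^sup>\<gamma>)' \<phi>\<^sup>n = \<gamma> / (\<gamma> + n) (\<phi>\<^sup>\<gamma>\<^sup>+\<^sup>n)'\<close>.
\<close>

text \<open>
  In terms of Laurent series this says that the residue of \<open>f' / f\<^sup>m\<^sup>+\<^sup>1\<close> vanishes for \<open>m > 0\<close>;
  here it follows from \<open>f' \<phi>\<^sup>m\<^sup>+\<^sup>1 = \<phi>\<^sup>m - t (\<phi>\<^sup>m)' / m\<close>.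
\<close>
lemma fps_deriv_mult_power_Suc_nth:
  fixes f \<phi> :: "'a :: field_char_0 fps"
  assumes "f * \<phi> = fps_X"
  shows "fps_nth (fps_deriv f * \<phi> ^ Suc m) m = (if m = 0 then fps_nth f 1 * fps_nth \<phi> 0 else 0)"
proof (cases m)
  case (Suc k)
  have d: "fps_deriv f * \<phi> = 1 - f * fps_deriv \<phi>"
    using arg_cong[OF assms, of fps_deriv] by (simp add: algebra_simps)
  have "fps_deriv f * \<phi> ^ Suc m = \<phi> ^ m - (f * \<phi>) * (\<phi> ^ k * fps_deriv \<phi>)"
    unfolding Suc power_Suc mult.assoc[symmetric] d by (simp add: algebra_simps)
  also have "f * \<phi> = fps_X" by (fact assms)
  finally have eq: "fps_deriv f * \<phi> ^ Suc m = \<phi> ^ m - fps_X * (\<phi> ^ k * fps_deriv \<phi>)" .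
  \<comment> \<open>Evaluating this coefficient of \<open>fps_deriv (\<phi> ^ m)\<close> in two ways
    and cancelling \<open>m\<close> shows that the two terms of \<open>eq\<close> agree in degree
    \<open>m\<close>.\<close>
  have "of_nat m * fps_nth (\<phi> ^ k * fps_deriv \<phi>) k = fps_nth (fps_deriv (\<phi> ^ m)) k"
    by (simp add: Suc fps_deriv_power mult.assoc mult.commute[of "\<phi> ^ k"] del: of_nat_Suc power_Suc)
  also have "\<dots> = of_nat m * fps_nth (\<phi> ^ m) m"
    by (simp add: Suc del: power_Suc)
  finally have "fps_nth (\<phi> ^ k * fps_deriv \<phi>) k = fps_nth (\<phi> ^ m) m"
    by (simp add: Suc del: of_nat_Suc power_Suc)
  then show ?thesis
    unfolding eq by (simp add: Suc del: power_Suc)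
qed simp

text \<open>Change of variables in a residue: with \<open>\<phi>\<close> read as
  \<open>t / f\<close>, the left side is the residue of \<open>K(f) f' / f^(m+1)\<close>, which
  equals that of \<open>K(u) / u^(m+1)\<close>.\<close>

lemma fps_compose_mult_deriv_mult_power_nth:
  fixes f \<phi> K :: "'a :: field_char_0 fps"
  assumes "f * \<phi> = fps_X" and f0: "fps_nth f 0 = 0"
  shows "fps_nth (fps_compose K f * fps_deriv f * \<phi> ^ Suc m) m = fps_nth K m"
proof (induction m arbitrary: K)
  case 0
  have "fps_nth f 1 * fps_nth \<phi> 0 = 1"
    using arg_cong[OF assms(1), of "\<lambda>g. fps_nth g 1"] f0 by (simp add: fps_mult_nth)
  then show ?case by simp
next
  case (Suc m)
  \<comment> \<open>Splitting off the constant term of \<open>K\<close> drives the induction: the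
    constant contributes 0 in degree \<open>Suc m\<close>, and the remaining factor \<open>f\<close>
    turns one \<open>\<phi>\<close> into \<open>fps_X\<close>.\<close>
  define L where "L = fps_shift 1 K"
  have K: "K = fps_const (fps_nth K 0) + fps_X * L"
    by (rule fps_ext) (simp add: L_def)
  have "fps_compose K f = fps_const (fps_nth K 0) + f * fps_compose L f"
    by (subst K) (simp add: fps_compose_add_distrib fps_compose_mult_distrib f0)
  then have "fps_compose K f * fps_deriv f * \<phi> ^ Suc (Suc m)
      = fps_const (fps_nth K 0) * (fps_deriv f * \<phi> ^ Suc (Suc m))
        + (f * \<phi>) * (fps_compose L f * fps_deriv f * \<phi> ^ Suc m)"
    by (simp add: algebra_simps)
  also have "f * \<phi> = fps_X" by (fact assms)
  finally have "fps_nth (fps_compose K f * fps_deriv f * \<phi> ^ Suc (Suc m)) (Suc m)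
      = fps_nth (fps_compose L f * fps_deriv f * \<phi> ^ Suc m) m"
    using fps_deriv_mult_power_Suc_nth[OF assms(1), of "Suc m"]
    by (simp del: power_Suc)
  also have "\<dots> = fps_nth L m" by (rule Suc.IH)
  finally show ?case by (simp add: L_def)
qed

lemma fps_deriv_compose_mult_power_nth:
  fixes f \<phi> H :: "'a :: field_char_0 fps"
  assumes "f * \<phi> = fps_X" and "fps_nth f 0 = 0"
  shows "fps_nth (fps_deriv (fps_compose H f) * \<phi> ^ Suc m) m = of_nat (Suc m) * fps_nth H (Suc m)"
  using fps_compose_mult_deriv_mult_power_nth[OF assms, of "fps_deriv H" m]
  by (simp add: fps_compose_deriv assms(2) del: power_Suc)

lemma power_determination_0:
  assumes "power_determination c P" and "c \<noteq> 0"
  shows "P 0 = 1"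
proof -
  have "P (0 + 1) = P 0 * P 1" and "P 1 = c"
    using assms(1) unfolding power_determination_def by blast+
  then show ?thesis using assms(2) by simp
qed

lemma power_determination_of_nat:
  assumes "power_determination c P" and "c \<noteq> 0"
  shows "P (of_nat n) = c ^ n"
  using assms by (induction n) (auto simp: power_determination_0 power_determination_def)

lemma power_determination_minus:
  assumes "power_determination c P" and "c \<noteq> 0"
  shows "power_determination (inverse c) (\<lambda>s. P (- s))"
proof -
  have add: "P (s + t) = P s * P t" for s t
    using assms(1) by (simp add: power_determination_def)
  have "P (- 1) * c = 1"
    using add[of "- 1" 1] power_determination_0[OF assms] assms(1)
    by (simp add: power_determination_def)
  then have "P (- 1) = inverse c"
    by (simp add: inverse_unique mult.commute)
  moreover have "P (- (s + t)) = P (- s) * P (- t)" for s t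
    using add[of "- s" "- t"] by (simp add: add.commute)
  ultimately show ?thesis by (simp add: power_determination_def)
qed

lemma fps_cpow_binomial:
  "fps_cpow Q f s =
     fps_const (Q s) *
     fps_compose (fps_binomial s) (fps_const (inverse (fps_nth f 0)) * f - 1)"
  by (simp add: fps_cpow_def fps_binomial_def)

lemma fps_cpow_nth_0 [simp]: "fps_nth (fps_cpow Q f s) 0 = Q s"
  by (simp add: fps_cpow_binomial)

lemma fps_cpow_add:
  assumes "power_determination (fps_nth f 0) Q" and "fps_nth f 0 \<noteq> 0"
  shows "fps_cpow Q f (s + t) = fps_cpow Q f s * fps_cpow Q f t"
proof -
  have "Q (s + t) = Q s * Q t"
    using assms(1) by (simp add: power_determination_def)
  then show ?thesis
    using assms(2)
    by (simp add: fps_cpow_binomial fps_binomial_add_mult fps_compose_mult_distrib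
        fps_const_mult[symmetric] mult_ac del: fps_const_mult)
qed

text \<open>Lets the integer power coming from Lagrange inversion be absorbed into a complex power
  by \<open>fps_cpow_add\<close>.\<close>

lemma fps_cpow_of_nat:
  assumes "power_determination (fps_nth f 0) Q" and "fps_nth f 0 \<noteq> 0"
  shows "fps_cpow Q f (of_nat n) = f ^ n"
proof -
  let ?c = "fps_nth f 0"
  have "fps_compose (fps_binomial (of_nat n)) (fps_const (inverse ?c) * f - 1)
      = (fps_const (inverse ?c) * f) ^ n"
    using assms(2)
    by (simp add: fps_binomial_of_nat fps_compose_add_distrib flip: fps_compose_power)
  then show ?thesis
    using assms
    by (simp add: fps_cpow_binomial power_determination_of_nat power_mult_distrib fps_const_power
        flip: mult.assoc)
       (simp flip: power_mult_distrib)
qed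

text \<open>Substituting \<open>u\<close> into the differential equation
  \<open>(1 + x) B' = s B\<close> of the binomial series gives this.\<close>

lemma fps_deriv_cpow:
  assumes "fps_nth f 0 \<noteq> 0"
  shows "f * fps_deriv (fps_cpow Q f s) = fps_const s * fps_deriv f * fps_cpow Q f s"
proof -
  define c where "c = fps_nth f 0"
  define u where "u = fps_const (inverse c) * f - 1"
  have u0: "fps_nth u 0 = 0" and c: "c \<noteq> 0"
    using assms by (simp_all add: u_def c_def)
  have f: "f = fps_const c * (1 + u)"
    using c by (simp add: u_def flip: mult.assoc)
  have "(1 + fps_X) * fps_deriv (fps_binomial s) = fps_const s * fps_binomial s"
    by (simp add: fps_binomial_deriv)
  then have "(1 + u) * fps_compose (fps_deriv (fps_binomial s)) u
      = fps_const s * fps_compose (fps_binomial s) u"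
    using u0 by (metis fps_X_fps_compose_startby0 fps_compose_1 fps_compose_add_distrib
        fps_compose_mult_distrib fps_const_compose)
  then have "(1 + u) * fps_deriv (fps_compose (fps_binomial s) u)
      = fps_const s * fps_deriv u * fps_compose (fps_binomial s) u"
    unfolding fps_compose_deriv[OF u0] mult.assoc[symmetric] by (simp add: mult_ac)
  then have "fps_const c * fps_const (Q s) * ((1 + u) * fps_deriv (fps_compose (fps_binomial s) u))
      = fps_const c * fps_const (Q s) * (fps_const s * fps_deriv u * fps_compose (fps_binomial s) u)"
    by simp
  moreover have "fps_cpow Q f s = fps_const (Q s) * fps_compose (fps_binomial s) u"
    by (simp add: fps_cpow_binomial u_def c_def)
  moreover have "fps_deriv f = fps_const c * fps_deriv u"
    by (subst f) simp
  ultimately show ?thesis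
    by (subst f) (simp only: fps_deriv_mult fps_deriv_const mult_zero_left add_0_right mult_ac)
qed

text \<open>Since \<open>h\<close> has no constant term, composition preserves the constant term of
  \<open>f\<close>, so the same normalisation and the same \<open>Q\<close> serve both
  sides.\<close>

lemma fps_cpow_compose:
  assumes "fps_nth f 0 \<noteq> 0" and "fps_nth h 0 = 0"
  shows "fps_compose (fps_cpow Q f s) h = fps_cpow Q (fps_compose f h) s"
  using assms
  by (simp add: fps_cpow_binomial fps_compose_mult_distrib fps_compose_sub_distrib
      flip: fps_compose_assoc)

text \<open>After multiplication by \<open>f\<close>, both sides become
  \<open>s (s + n) f' f^(s + n)\<close>; then the nonzero factor \<open>f\<close> cancels.\<close>

lemma fps_deriv_cpow_mult_power:
  assumes "power_determination (fps_nth f 0) Q" and "fps_nth f 0 \<noteq> 0"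
  shows "fps_const (s + of_nat n) * (fps_deriv (fps_cpow Q f s) * f ^ n)
       = fps_const s * fps_deriv (fps_cpow Q f (s + of_nat n))"
proof -
  have "f * (fps_const (s + of_nat n) * (fps_deriv (fps_cpow Q f s) * f ^ n))
      = fps_const (s + of_nat n) * (f * fps_deriv (fps_cpow Q f s)) * f ^ n"
    by (simp only: mult_ac)
  also have "\<dots> = fps_const s * (fps_const (s + of_nat n) * fps_deriv f
      * (fps_cpow Q f s * fps_cpow Q f (of_nat n)))"
    by (simp only: fps_deriv_cpow[OF assms(2)] fps_cpow_of_nat[OF assms] mult_ac)
  also have "\<dots> = fps_const s * (f * fps_deriv (fps_cpow Q f (s + of_nat n)))"
    by (simp only: fps_deriv_cpow[OF assms(2)] fps_cpow_add[OF assms, symmetric])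
  finally have "f * (fps_const (s + of_nat n) * (fps_deriv (fps_cpow Q f s) * f ^ n))
      = f * (fps_const s * fps_deriv (fps_cpow Q f (s + of_nat n)))"
    by (simp only: mult_ac)
  moreover have "f \<noteq> 0" using assms(2) by auto
  ultimately show ?thesis by simp
qed

lemma fps_cpow_inv_nth:
  fixes f :: "complex fps"
  assumes f0: "fps_nth f 0 = 0" and f1: "fps_nth f 1 \<noteq> 0"
    and Q: "power_determination (inverse (fps_nth f 1)) Q"
  shows "(s + of_nat n) * fps_nth (fps_cpow Q (fps_inv f / fps_X) s) n
       = s * fps_nth (fps_cpow Q (fps_X / f) (s + of_nat n)) n"
proof (cases n)
  case (Suc m)
  define \<phi> where "\<phi> = fps_X / f"
  define \<psi> where "\<psi> = fps_inv f / fps_X"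
  have sub: "subdegree f = 1"
    using f0 f1 by (intro subdegreeI) auto
  have "f dvd fps_X"
    using sub f1 by (subst fps_dvd_iff) auto
  then have f\<phi>: "f * \<phi> = fps_X"
    by (simp add: \<phi>_def)
  have \<phi>0: "fps_nth \<phi> 0 = inverse (fps_nth f 1)"
    by (simp add: \<phi>_def fps_divide_def sub)
  have "fps_nth (fps_inv f) 0 = 0"
    by (simp add: fps_inv_def)
  then have \<psi>: "fps_inv f = \<psi> * fps_X"
    by (intro fps_ext) (simp add: \<psi>_def fps_divide_def)
  \<comment> \<open>Composing \<open>fps_inv f = \<psi> * fps_X\<close> with \<open>f\<close> gives
    \<open>fps_X = f * \<phi>\<close>, and \<open>f\<close> cancels.\<close>
  have "f * fps_compose \<psi> f = fps_compose (fps_inv f) f"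
    using f0 by (simp add: \<psi> fps_compose_mult_distrib)
  also have "\<dots> = f * \<phi>"
    using fps_inv[OF f0 f1] f\<phi> by simp
  finally have comp: "fps_compose \<psi> f = \<phi>"
    using f1 by auto
  then have \<psi>0: "fps_nth \<psi> 0 \<noteq> 0"
    using \<phi>0 f1 by auto
  have Q': "power_determination (fps_nth \<phi> 0) Q" and \<phi>00: "fps_nth \<phi> 0 \<noteq> 0"
    using Q f1 \<phi>0 by auto
  \<comment> \<open>The factor \<open>n = Suc m\<close> comes from reading coefficients off
    derivatives on both sides; it is nonzero and cancels at the end.\<close>
  have "of_nat n * ((s + of_nat n) * fps_nth (fps_cpow Q \<psi> s) n)
      = (s + of_nat n) * fps_nth (fps_deriv (fps_compose (fps_cpow Q \<psi> s) f) * \<phi> ^ n) m"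
    using fps_deriv_compose_mult_power_nth[OF f\<phi> f0, of "fps_cpow Q \<psi> s" m]
    by (simp only: Suc mult_ac)
  also have "\<dots> = (s + of_nat n) * fps_nth (fps_deriv (fps_cpow Q \<phi> s) * \<phi> ^ n) m"
    by (simp only: fps_cpow_compose[OF \<psi>0 f0] comp)
  also have "\<dots> = fps_nth (fps_const s * fps_deriv (fps_cpow Q \<phi> (s + of_nat n))) m"
    by (simp only: fps_deriv_cpow_mult_power[OF Q' \<phi>00, symmetric] fps_mult_left_const_nth)
  also have "\<dots> = of_nat n * (s * fps_nth (fps_cpow Q \<phi> (s + of_nat n)) n)"
    by (simp add: Suc)
  finally show ?thesis
    by (simp add: Suc \<phi>_def \<psi>_def del: of_nat_Suc)
qed simp

theorem theorem4p4:
  fixes M :: "'a measure" and Y :: "'a \<Rightarrow> real"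
    and l :: real and g :: complex and P :: "complex \<Rightarrow> complex" and n :: nat
  assumes "prob_space M"
    and "Y \<in> borel_measurable M"
    and "has_mgf M Y"
    and "(\<integral>\<omega>. Y \<omega> \<partial>M) \<noteq> 0"
    and "power_determination (complex_of_real (\<integral>\<omega>. Y \<omega> \<partial>M)) P"
    and "l \<noteq> 0"
    and "g \<noteq> - of_nat n"
  shows "prob_deg_daehee P M Y l g n =
           g / (g + of_nat n) * prob_deg_bernoulli P M Y l (of_nat n + g) n"
proof -
  define f where "f = prob_deg_exp M Y l - 1"
  have f0: "fps_nth f 0 = 0" and f1: "fps_nth f 1 = complex_of_real (\<integral>\<omega>. Y \<omega> \<partial>M)"
    using prob_space.prob_deg_exp_minus_1_nth[OF assms(1), of Y l] by (simp_all add: f_def)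
  have "power_determination (inverse (fps_nth f 1)) (\<lambda>s. P (- s))"
    using assms(4,5) unfolding f1 by (intro power_determination_minus) auto
  then have "(g + of_nat n) * fps_nth (fps_cpow (\<lambda>s. P (- s)) (fps_inv f / fps_X) g) n
      = g * fps_nth (fps_cpow (\<lambda>s. P (- s)) (fps_X / f) (g + of_nat n)) n"
    using f0 f1 assms(4) by (intro fps_cpow_inv_nth) auto
  \<comment> \<open>Only here is the exceptional exponent excluded: the identity just obtained still
    carries the factor \<open>g + of_nat n\<close>.\<close>
  moreover have "g + of_nat n \<noteq> 0"
    using assms(7) by (simp add: add_eq_0_iff2)
  ultimately have "fps_nth (fps_cpow (\<lambda>s. P (- s)) (fps_inv f / fps_X) g) n
      = g / (g + of_nat n) * fps_nth (fps_cpow (\<lambda>s. P (- s)) (fps_X / f) (g + of_nat n)) n"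
    by (simp add: field_simps)
  then show ?thesis
    unfolding prob_deg_daehee_def prob_deg_bernoulli_def prob_deg_log_def f_def[symmetric]
    by (simp add: add.commute)
qed

end
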